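(* Let $p$ be an odd prime. Then $$t_p\equiv \big(1+4(-1)^{\frac{p-1}{2}}\big)p^2\pmod{p^3},$$ $$t_{p-1}\equiv (-1)^{\frac{p-1}{2}}\big(2p+2^p-2+(pB_{p-1})^2\big)\pmod{p^2},$$ $$t_{\frac{p-1}{2}}\equiv pB_{p-1}-p+2^{p-1}-1\pmod{p^2},$$ $$t_{\frac{p+1}{2}}\equiv pB_{p-1}-3p+2^{p-1}-1\pmod{p^2},$$ and, if $p\equiv 3\pmod 4$, $$t_{\frac{p-3}{4}}\equiv \pm\frac{1}{\binom{(p-1)/2}{(p-3)/4}}\pmod p$$ (that is, the congruence holds for at least one of the two choices of sign).
   Context: The sequence $\{t_n\}_{n\ge 0}$ is defined by $t_0=1$, $t_1=5$ and $t_{n+1}=(8n^2+12n+5)t_n-4n^2(2n+1)^2t_{n-1}$ for $n\ge 1$. The Bernoulli numbers $B_n$ are defined by $B_0=1$ and $\sum_{k=0}^{n-1}\binom{n}{k}B_k=0$ for $n\ge 2$. Congruences modulo a power of $p$ are between rational numbers whose reduced denominators are not divisible by $p$ (that is, $a\equiv b\pmod{p^r}$ means $a-b\in p^r\mathbb{Z}_{(p)}$); note that $pB_{p-1}$ is such a rational number. *)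

theory Defs
  imports "HOL-Number_Theory.Number_Theory"
begin

text \<open>The recurrence is shifted by one (its index is \<open>Suc n\<close>) to fit pattern
  matching; \<open>t_seq_rec\<close> is the unshifted form.\<close>

fun t_seq :: "nat \<Rightarrow> int" where
  "t_seq 0 = 1"
| "t_seq (Suc 0) = 5"
| "t_seq (Suc (Suc n)) =
     (8 * int (Suc n) ^ 2 + 12 * int (Suc n) + 5) * t_seq (Suc n)
       - 4 * int (Suc n) ^ 2 * (2 * int (Suc n) + 1) ^ 2 * t_seq n"

lemma t_seq_rec:
  assumes "n \<ge> 1"
  shows "t_seq (n + 1) = (8 * int n ^ 2 + 12 * int n + 5) * t_seq n
           - 4 * int n ^ 2 * (2 * int n + 1) ^ 2 * t_seq (n - 1)"
proof -
  from assms obtain m where "n = Suc m" by (cases n) auto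
  then show ?thesis by simp
qed

text \<open>Bernoulli numbers, with \<open>bernoulli 1 = -1/2\<close>. The recursion is
  \<open>(\<Sum>k<m. (m choose k) * bernoulli k) = 0\<close> for \<open>m = n + 2\<close>, solved for its last term;
  see \<open>bernoulli_sum_eq_0\<close>.\<close>

fun bernoulli :: "nat \<Rightarrow> rat" where
  "bernoulli 0 = 1"
| "bernoulli (Suc n) = - (\<Sum>k\<le>n. of_nat ((n + 2) choose k) * bernoulli k) / of_nat (n + 2)"

lemma bernoulli_sum_eq_0:
  assumes "n \<ge> 2"
  shows "(\<Sum>k<n. of_nat (n choose k) * bernoulli k) = 0"
proof -
  from assms obtain m where n: "n = Suc (Suc m)"
    by (metis Suc_le_D numeral_2_eq_2 Suc_le_mono)
  have "(of_nat (m + 2) :: rat) \<noteq> 0"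
    by (simp only: of_nat_eq_0_iff)
  moreover have "Suc (Suc m) choose Suc m = m + 2"
    using binomial_symmetric[of "Suc m" "Suc (Suc m)"] by simp
  ultimately show ?thesis
    unfolding n by (simp add: lessThan_Suc_atMost del: of_nat_add of_nat_Suc binomial_Suc_Suc)
qed

text \<open>The ring of rationals whose reduced denominator is not divisible by \<open>p\<close>
  (\<open>quotient_of\<close> yields the reduced fraction with positive denominator).\<close>

definition p_integral :: "nat \<Rightarrow> rat set" where
  "p_integral p = {x. \<not> int p dvd snd (quotient_of x)}"

definition rat_cong :: "nat \<Rightarrow> nat \<Rightarrow> rat \<Rightarrow> rat \<Rightarrow> bool" where
  "rat_cong p r a b \<longleftrightarrow>
     a \<in> p_integral p \<and> b \<in> p_integral p \<and>
     a - b \<in> (\<lambda>c. of_nat p ^ r * c) ` p_integral p"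

end

theory Submission
  imports Defs "HOL-Computational_Algebra.Formal_Power_Series"
begin

text \<open>
  Put \<open>c k = (2 k choose k) / 4 ^ k\<close>. Everything rests on the closed form
  \<open>t n = 4 ^ n * (n!) ^ 2 * (\<Sum>k\<le>n. c k ^ 2)\<close> (lemma \<open>t_seq_eq_sum_squares\<close>). It is found by
  reduction of order: the series \<open>\<Sum>n. t n / (2 n + 1)! * y ^ (2 n + 1)\<close> is
  \<open>artanh y / sqrt (1 - y ^ 2)\<close>, which yields the first-order recurrence
  \<open>(2 n + 1) * r n = 2 n * r (n - 1) + c n\<close> for \<open>r n = t n / (2 n + 1)!\<close>, and iterating it gives
  the sum.

  Let \<open>p = 2 m + 1\<close> be prime and \<open>e = (-1) ^ m\<close>. For \<open>k \<le> m\<close> one has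
  \<open>c k ^ 2 \<equiv> (m choose k) * ((-m-1) choose k)\<close> modulo \<open>p ^ 2\<close>, because the ratios of consecutive
  terms are \<open>(2k+1) ^ 2 / (2k+2) ^ 2\<close> and \<open>((2k+1) ^ 2 - p ^ 2) / (2k+2) ^ 2\<close>
  (lemma \<open>cbin_square_cong\<close>). Two facts follow. Vandermonde's identity gives
  \<open>(\<Sum>k\<le>m. c k ^ 2) \<equiv> e\<close>, and the terms with \<open>m < k < p\<close> contribute nothing since \<open>p\<close> divides
  \<open>c k\<close> there. The single term \<open>k = m\<close> reads \<open>c m ^ 2 \<equiv> e * 4 ^ m * c m\<close>, and cancelling
  \<open>c m\<close> gives Morley's congruence in the form \<open>c m \<equiv> e * 4 ^ m\<close>, that is
  \<open>(p-1)! \<equiv> e * (4 ^ m * m!) ^ 2\<close> modulo \<open>p ^ 2\<close>.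

  With \<open>4 ^ m = 2 ^ (p-1)\<close> these evaluate \<open>t p\<close>, \<open>t (p-1)\<close> and \<open>t m\<close> in terms of \<open>(p-1)!\<close> and
  \<open>2 ^ (p-1)\<close>. The factorial is turned into a Bernoulli number by Glaisher's congruence
  \<open>p * B (p-1) \<equiv> p + (p-1)!\<close> modulo \<open>p ^ 2\<close> (lemma \<open>glaisher_bernoulli_cong\<close>), which is obtained
  by evaluating \<open>\<Sum>a<p. a ^ (p-1)\<close> in two ways. The value at \<open>m + 1\<close> comes from the defining
  recurrence at \<open>n = m\<close>, whose last coefficient is divisible by \<open>(2 m + 1) ^ 2 = p ^ 2\<close>.

  If \<open>m = 2 n + 1\<close>, the weaker congruence \<open>c k \<equiv> (-1) ^ k * (m choose k)\<close> modulo \<open>p\<close> makes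
  \<open>c k ^ 2\<close> symmetric under \<open>k \<mapsto> m - k\<close>, so the sum up to \<open>n\<close> is half of the sum up to \<open>m\<close>. This
  gives \<open>t n * (m choose n) \<equiv> - (2 ^ m * m!)\<close> modulo \<open>p\<close>, and the square of the right-hand
  side is \<open>1\<close>.
\<close>

section \<open>Rational numbers integral at a prime\<close>

text \<open>Closure under ring operations is immediate for arbitrary fractions with denominator prime
  to \<open>p\<close>, whereas reduced fractions do not add and multiply entrywise.\<close>
lemma p_integral_iff:
  "x \<in> p_integral p \<longleftrightarrow> (\<exists>a b. \<not> int p dvd b \<and> x = of_int a / of_int b)"
proof
  assume x: "x \<in> p_integral p"
  obtain a b where ab: "quotient_of x = (a, b)" by (cases "quotient_of x")
  then have "x = of_int a / of_int b" by (rule quotient_of_div)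
  with x ab show "\<exists>a b. \<not> int p dvd b \<and> x = of_int a / of_int b"
    unfolding p_integral_def by auto
next
  assume "\<exists>a b. \<not> int p dvd b \<and> x = of_int a / of_int b"
  then obtain a b where b: "\<not> int p dvd b" and x: "x = of_int a / of_int b" by blast
  obtain a' b' where q: "quotient_of x = (a', b')" by (cases "quotient_of x")
  have b': "b' > 0" "coprime a' b'" "x = of_int a' / of_int b'"
    using q by (auto intro: quotient_of_denom_pos quotient_of_coprime quotient_of_div)
  have "b \<noteq> 0" using b by auto
  then have "(of_int (a * b') :: rat) = of_int (a' * b)"
    using x b' by (simp add: field_simps)
  then have "b' dvd a' * b" by (metis of_int_eq_iff dvd_triv_right)
  then have "b' dvd b" using b'(2) by (simp add: coprime_commute coprime_dvd_mult_right_iff)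
  then show "x \<in> p_integral p" using b q unfolding p_integral_def by (auto dest: dvd_trans)
qed

locale prime_localization =
  fixes p :: nat
  assumes p: "prime p"
begin

lemma p_integral_of_int [simp]: "of_int a \<in> p_integral p"
proof -
  have "\<not> int p dvd 1" using prime_gt_1_nat[OF p] by simp
  then show ?thesis unfolding p_integral_iff by (intro exI[of _ a] exI[of _ 1]) auto
qed

lemma p_integral_of_nat [simp]: "of_nat a \<in> p_integral p"
  using p_integral_of_int[of "int a"] by simp

lemma p_integral_numeral [simp]:
  "0 \<in> p_integral p" "1 \<in> p_integral p" "numeral n \<in> p_integral p"
  using p_integral_of_int[of 0] p_integral_of_int[of 1] p_integral_of_int[of "numeral n"] by simp_all

lemma p_integral_add: "x \<in> p_integral p \<Longrightarrow> y \<in> p_integral p \<Longrightarrow> x + y \<in> p_integral p"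
  and p_integral_mult: "x \<in> p_integral p \<Longrightarrow> y \<in> p_integral p \<Longrightarrow> x * y \<in> p_integral p"
proof -
  assume "x \<in> p_integral p" "y \<in> p_integral p"
  then obtain a b c d where *: "\<not> int p dvd b" "x = of_int a / of_int b"
      "\<not> int p dvd d" "y = of_int c / of_int d"
    unfolding p_integral_iff by blast
  have bd: "\<not> int p dvd b * d" using * p by (simp add: prime_dvd_mult_iff)
  have "b \<noteq> 0" "d \<noteq> 0" using * by auto
  then have "x + y = of_int (a * d + c * b) / of_int (b * d)" "x * y = of_int (a * c) / of_int (b * d)"
    using * by (simp_all add: field_simps)
  with bd show "x + y \<in> p_integral p" "x * y \<in> p_integral p" unfolding p_integral_iff by blast+
qed

lemma p_integral_minus [simp]: "x \<in> p_integral p \<Longrightarrow> - x \<in> p_integral p"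
  using p_integral_mult[of "of_int (-1)" x] p_integral_of_int[of "-1"] by simp

lemma p_integral_diff: "x \<in> p_integral p \<Longrightarrow> y \<in> p_integral p \<Longrightarrow> x - y \<in> p_integral p"
  using p_integral_add[of x "- y"] by simp

lemma p_integral_power: "x \<in> p_integral p \<Longrightarrow> x ^ n \<in> p_integral p"
  by (induction n) (auto intro: p_integral_mult)

lemma p_integral_sum: "(\<And>i. i \<in> A \<Longrightarrow> f i \<in> p_integral p) \<Longrightarrow> sum f A \<in> p_integral p"
  by (induction A rule: infinite_finite_induct) (auto intro: p_integral_add)

lemma p_integral_divide_of_int:
  assumes "x \<in> p_integral p" "\<not> int p dvd b"
  shows "x / of_int b \<in> p_integral p"
proof -
  have "of_int 1 / of_int b \<in> p_integral p" using assms(2) unfolding p_integral_iff by blast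
  from p_integral_mult[OF assms(1) this] show ?thesis by simp
qed

lemma p_integral_divide_of_nat:
  "x \<in> p_integral p \<Longrightarrow> \<not> p dvd b \<Longrightarrow> x / of_nat b \<in> p_integral p"
  using p_integral_divide_of_int[of x "int b"] by simp

lemmas p_integral_intros = p_integral_add p_integral_mult p_integral_diff p_integral_power
  p_integral_sum p_integral_divide_of_nat

text \<open>Since \<open>rat_cong\<close> demands that both sides be \<open>p\<close>-integral, it is compatible with products,
  powers and sums without side conditions.\<close>
lemma rat_congI:
  assumes "b \<in> p_integral p" "c \<in> p_integral p" "a = b + of_nat p ^ r * c"
  shows "rat_cong p r a b"
  using assms unfolding rat_cong_def by (auto intro!: p_integral_intros)

lemma rat_congE:
  assumes "rat_cong p r a b"
  obtains c where "c \<in> p_integral p" "a = b + of_nat p ^ r * c"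
  using assms unfolding rat_cong_def by (auto simp: algebra_simps)

lemma rat_cong_integral:
  assumes "rat_cong p r a b" shows "a \<in> p_integral p" "b \<in> p_integral p"
  using assms unfolding rat_cong_def by auto

lemma rat_cong_refl: "a \<in> p_integral p \<Longrightarrow> rat_cong p r a a"
  by (rule rat_congI[of _ 0]) auto

lemma rat_cong_const: "rat_cong p r (of_int a) (of_int a)"
  by (intro rat_cong_refl p_integral_of_int)

lemma rat_cong_add:
  assumes "rat_cong p r a b" "rat_cong p r c d" shows "rat_cong p r (a + c) (b + d)"
proof -
  obtain x where x: "x \<in> p_integral p" "a = b + of_nat p ^ r * x" using assms(1) by (rule rat_congE)
  obtain y where y: "y \<in> p_integral p" "c = d + of_nat p ^ r * y" using assms(2) by (rule rat_congE)
  show ?thesis using x y assms[THEN rat_cong_integral(2)]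
    by (intro rat_congI[of _ "x + y"]) (auto intro: p_integral_intros simp: algebra_simps)
qed

lemma rat_cong_mult:
  assumes "rat_cong p r a b" "rat_cong p r c d" shows "rat_cong p r (a * c) (b * d)"
proof -
  obtain x where x: "x \<in> p_integral p" "a = b + of_nat p ^ r * x" using assms(1) by (rule rat_congE)
  obtain y where y: "y \<in> p_integral p" "c = d + of_nat p ^ r * y" using assms(2) by (rule rat_congE)
  show ?thesis using x y assms[THEN rat_cong_integral(1)] assms[THEN rat_cong_integral(2)]
    by (intro rat_congI[of _ "x * c + b * y"]) (auto intro!: p_integral_intros simp: algebra_simps)
qed

lemma rat_cong_sym:
  assumes "rat_cong p r a b" shows "rat_cong p r b a"
proof -
  obtain x where "x \<in> p_integral p" "a = b + of_nat p ^ r * x" using assms by (rule rat_congE)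
  with rat_cong_integral[OF assms] show ?thesis by (intro rat_congI[of _ "- x"]) auto
qed

lemma rat_cong_trans [trans]:
  assumes "rat_cong p r a b" "rat_cong p r b c" shows "rat_cong p r a c"
proof -
  obtain x where x: "x \<in> p_integral p" "a = b + of_nat p ^ r * x" using assms(1) by (rule rat_congE)
  obtain y where y: "y \<in> p_integral p" "b = c + of_nat p ^ r * y" using assms(2) by (rule rat_congE)
  show ?thesis using x y rat_cong_integral[OF assms(2)]
    by (intro rat_congI[of _ "x + y"]) (auto intro: p_integral_add simp: algebra_simps)
qed

lemma rat_cong_minus: "rat_cong p r a b \<Longrightarrow> rat_cong p r (- a) (- b)"
  using rat_cong_mult[OF rat_cong_refl[of "of_int (-1)"]] p_integral_of_int[of "-1"] by force

lemma rat_cong_power: "rat_cong p r a b \<Longrightarrow> rat_cong p r (a ^ n) (b ^ n)"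
  by (induction n) (auto intro: rat_cong_mult rat_cong_refl)

lemma rat_cong_sum:
  "(\<And>i. i \<in> A \<Longrightarrow> rat_cong p r (f i) (g i)) \<Longrightarrow> rat_cong p r (sum f A) (sum g A)"
  by (induction A rule: infinite_finite_induct) (auto intro: rat_cong_add rat_cong_refl)

text \<open>This lets integer arguments use the theory of divisibility, and only those parts that
  contain genuine fractions or Bernoulli numbers stay in the rationals.\<close>
lemma rat_cong_of_int_iff:
  "rat_cong p r (of_int a) (of_int b) \<longleftrightarrow> [a = b] (mod int p ^ r)"
proof
  assume "[a = b] (mod int p ^ r)"
  then obtain k where "a = b + int p ^ r * k" by (metis cong_iff_lin cong_sym)
  then show "rat_cong p r (of_int a) (of_int b)"
    by (intro rat_congI[of _ "of_int k"]) auto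
next
  assume "rat_cong p r (of_int a) (of_int b)"
  then obtain x where "x \<in> p_integral p" and eq: "of_int a = of_int b + of_nat p ^ r * x"
    by (rule rat_congE)
  then obtain u v where v: "\<not> int p dvd v" "x = of_int u / of_int v" unfolding p_integral_iff by blast
  then have "v \<noteq> 0" by auto
  with eq v have "(of_int ((a - b) * v) :: rat) = of_int (int p ^ r * u)"
    by (simp add: field_simps)
  then have "int p ^ r dvd (a - b) * v" by (metis of_int_eq_iff dvd_triv_left)
  moreover have "coprime (int p ^ r) v"
    using v p by (simp add: prime_imp_coprime)
  ultimately have "int p ^ r dvd a - b" by (simp add: coprime_dvd_mult_left_iff)
  then show "[a = b] (mod int p ^ r)" by (simp add: cong_iff_dvd_diff)
qed

lemma rat_cong_mono:
  assumes "rat_cong p s a b" "r \<le> s" shows "rat_cong p r a b"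
proof -
  obtain x where x: "x \<in> p_integral p" "a = b + of_nat p ^ s * x" using assms(1) by (rule rat_congE)
  with assms(2) rat_cong_integral[OF assms(1)] show ?thesis
    by (intro rat_congI[of _ "of_nat p ^ (s - r) * x"])
       (auto intro!: p_integral_intros simp flip: power_add simp: mult.assoc[symmetric])
qed

lemma rat_cong_cancel:
  assumes "rat_cong p r (of_nat u * a) (of_nat u * b)" "\<not> p dvd u"
  shows "rat_cong p r a b"
proof -
  have u: "of_nat u \<noteq> (0::rat)" using assms(2) by (metis dvd_0_right of_nat_eq_0_iff)
  have "1 / of_nat u \<in> p_integral p" using assms(2) by (intro p_integral_divide_of_nat) auto
  from rat_cong_mult[OF rat_cong_refl[OF this] assms(1)] u show ?thesis by simp
qed

text \<open>An explicit factor \<open>p ^ s\<close> raises the precision: this is how a congruence modulo \<open>p\<close> for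
  the cofactor of \<open>p ^ 2\<close> in \<open>t p\<close> becomes one modulo \<open>p ^ 3\<close>.\<close>
lemma rat_cong_scale:
  assumes "rat_cong p r a b" shows "rat_cong p (s + r) (of_nat p ^ s * a) (of_nat p ^ s * b)"
proof -
  obtain x where x: "x \<in> p_integral p" "a = b + of_nat p ^ r * x" using assms(1) by (rule rat_congE)
  with rat_cong_integral[OF assms(1)] show ?thesis
    by (intro rat_congI[of _ x]) (auto intro!: p_integral_intros simp: algebra_simps power_add)
qed

end

section \<open>A closed form for the sequence\<close>

text \<open>The coefficient of \<open>x ^ k\<close> in \<open>(1 - x) powr (-1/2)\<close>, that is
  \<open>(-1) ^ k * ((-1/2) gchoose k)\<close>.\<close>
definition cbin :: "nat \<Rightarrow> rat" where
  "cbin k = of_nat ((2 * k) choose k) / 4 ^ k"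

lemma cbin_0 [simp]: "cbin 0 = 1"
  by (simp add: cbin_def)

lemma cbin_Suc: "of_nat (2 * k + 2) * cbin (Suc k) = of_nat (2 * k + 1) * cbin k"
proof -
  have fact_eq: "of_nat ((2 * n) choose n) * (fact n * fact n) = (fact (2 * n) :: rat)" for n
    by (simp add: binomial_fact)
  have f: "fact (2 * Suc k) = (fact (2 * k) * (of_nat (2 * k + 1) * of_nat (2 * k + 2)) :: rat)"
    by (simp add: algebra_simps)
  have "of_nat ((2 * Suc k) choose Suc k) * (fact k * fact k * (of_nat (Suc k) * of_nat (Suc k)))
      = of_nat ((2 * k) choose k) * (fact k * fact k) * (of_nat (2 * k + 1) * of_nat (2 * k + 2) :: rat)"
    using fact_eq[of "Suc k"] unfolding f fact_eq[of k, symmetric] by (simp add: algebra_simps)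
  then have "of_nat ((2 * Suc k) choose Suc k) * (of_nat (Suc k) * of_nat (Suc k))
      = of_nat ((2 * k) choose k) * (of_nat (2 * k + 1) * of_nat (2 * k + 2) :: rat)"
    by (simp add: fact_nonzero)
  also have "(of_nat (2 * k + 2) :: rat) = 2 * of_nat (Suc k)" by simp
  finally have "of_nat ((2 * Suc k) choose Suc k) * of_nat (Suc k)
      = 2 * of_nat (2 * k + 1) * (of_nat ((2 * k) choose k) :: rat)"
    by (simp del: of_nat_Suc of_nat_add add: mult_ac)
  moreover define A :: rat where "A = of_nat ((2 * Suc k) choose Suc k)"
  moreover define B :: rat where "B = of_nat ((2 * k) choose k)"
  ultimately have AB: "A * of_nat (Suc k) = 2 * of_nat (2 * k + 1) * B" by simp
  have "of_nat (2 * k + 2) * (A / 4 ^ Suc k) = 2 * (A * of_nat (Suc k)) / (4 * 4 ^ k)"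
    by (simp add: algebra_simps)
  also have "\<dots> = of_nat (2 * k + 1) * (B / 4 ^ k)" unfolding AB by (simp add: field_simps)
  finally show ?thesis unfolding cbin_def A_def[symmetric] B_def[symmetric] .
qed

lemma cbin_Suc_eq: "cbin (Suc k) = cbin k * (2 * of_nat k + 1) / (2 * of_nat k + 2)"
proof -
  have "(2 * of_nat k + 2 :: rat) = of_nat (2 * k + 2)" by simp
  also have "\<dots> \<noteq> 0" by (simp only: of_nat_eq_0_iff)
  finally show ?thesis using cbin_Suc[of k] by (simp add: eq_divide_eq mult_ac add_ac)
qed

text \<open>Writing \<open>U n\<close> for the sum on the right, the recurrence for \<open>t\<close> turns into
  \<open>4 (n+1) ^ 2 * (U (n+1) - U n) = (2n+1) ^ 2 * (U n - U (n-1))\<close>, which only says that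
  consecutive \<open>cbin\<close> have the ratio \<open>(2n+1) / (2n+2)\<close>.\<close>
lemma t_seq_eq_sum_squares:
  "of_int (t_seq n) = 4 ^ n * fact n ^ 2 * (\<Sum>k\<le>n. cbin k ^ 2)"
proof (induction n rule: t_seq.induct)
  case 1
  show ?case by simp
next
  case 2
  have "cbin (Suc 0) = 1 / 2" by (simp add: cbin_def)
  show ?case by (simp add: \<open>cbin (Suc 0) = 1 / 2\<close> power2_eq_square)
next
  case (3 n)
  define U where "U = (\<Sum>k\<le>n. cbin k ^ 2)"
  define x :: rat where "x = of_nat (Suc n)"
  define C where "C = cbin (Suc n)"
  have eq: "2 * (x + 1) * cbin (Suc (Suc n)) = (2 * x + 1) * C"
    using cbin_Suc[of "Suc n"] by (simp add: x_def C_def algebra_simps)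
  have f1: "fact (Suc n) = x * fact n" and f2: "fact (Suc (Suc n)) = (x + 1) * (x * fact n)"
    by (simp_all add: x_def)
  have "of_int (t_seq (Suc (Suc n)))
      = (8 * x ^ 2 + 12 * x + 5) * of_int (t_seq (Suc n)) - 4 * x ^ 2 * (2 * x + 1) ^ 2 * of_int (t_seq n)"
    by (simp add: x_def)
  also have "\<dots> = (8 * x ^ 2 + 12 * x + 5) * (4 ^ Suc n * (x * fact n) ^ 2 * (U + C ^ 2))
      - 4 * x ^ 2 * (2 * x + 1) ^ 2 * (4 ^ n * fact n ^ 2 * U)"
    unfolding 3 f1 by (simp add: U_def C_def)
  also have "\<dots> = 4 ^ Suc n * (x * fact n) ^ 2 * (4 * (x + 1) ^ 2 * (U + C ^ 2) + ((2 * x + 1) * C) ^ 2)"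
    by (simp add: algebra_simps power2_eq_square)
  also have "\<dots> = 4 ^ Suc (Suc n) * fact (Suc (Suc n)) ^ 2 * (U + C ^ 2 + cbin (Suc (Suc n)) ^ 2)"
    unfolding f2 eq[symmetric] by (simp add: algebra_simps power2_eq_square)
  finally show ?case by (simp only: U_def C_def sum.atMost_Suc)
qed

section \<open>Central binomial coefficients modulo the square of an odd prime\<close>

text \<open>Reversing the first factor turns the sum into a Vandermonde convolution, equal to the
  coefficient \<open>(-1) gchoose m\<close>.\<close>
lemma sum_gbinomial_products:
  "(\<Sum>k\<le>m. (of_nat m gchoose k) * ((- of_nat m - 1 :: rat) gchoose k)) = (-1) ^ m"
proof -
  have "(\<Sum>k\<le>m. (of_nat m gchoose k) * ((- of_nat m - 1 :: rat) gchoose k))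
      = (\<Sum>k\<le>m. ((- of_nat m - 1) gchoose k) * (of_nat m gchoose (m - k)))"
    by (intro sum.cong refl) (subst gbinomial_of_nat_symmetric, simp_all)
  also have "\<dots> = ((- of_nat m - 1 + of_nat m :: rat) gchoose m)"
    unfolding gbinomial_Vandermonde[symmetric] atMost_atLeast0 by simp
  also have "\<dots> = (-1) ^ m" by (simp add: gbinomial_minus flip: binomial_gbinomial)
  finally show ?thesis .
qed

text \<open>For \<open>x = m\<close> and \<open>p = 2 * m + 1\<close> the factor on the right is
  \<open>((2 * k + 1) ^ 2 - p ^ 2) / 4\<close>.\<close>
lemma gbinomial_product_Suc:
  fixes x :: rat
  shows "of_nat (Suc k) ^ 2 * ((x gchoose Suc k) * ((- x - 1) gchoose Suc k))
    = (of_nat k - x) * (of_nat k + x + 1) * ((x gchoose k) * ((- x - 1) gchoose k))"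
proof -
  have *: "of_nat (Suc k) * (y gchoose Suc k) = (y - of_nat k) * (y gchoose k)" for y :: rat
    using gbinomial_mult_1[of y k] by (simp add: algebra_simps)
  have "of_nat (Suc k) ^ 2 * ((x gchoose Suc k) * ((- x - 1) gchoose Suc k))
     = (of_nat (Suc k) * (x gchoose Suc k)) * (of_nat (Suc k) * ((- x - 1) gchoose Suc k))"
    by (simp add: power2_eq_square mult_ac)
  also have "\<dots> = (of_nat k - x) * (of_nat k + x + 1) * ((x gchoose k) * ((- x - 1) gchoose k))"
    unfolding * by (simp add: algebra_simps)
  finally show ?thesis .
qed

locale odd_prime_localization = prime_localization +
  fixes m :: nat
  assumes p_eq: "p = 2 * m + 1"
begin

lemma not_dvd_below: "0 < k \<Longrightarrow> k < p \<Longrightarrow> \<not> p dvd k"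
  by (auto dest: dvd_imp_le)

lemma odd_p: "odd p"
  using p_eq by simp

lemma m_pos: "m > 0"
  using p p_eq by (cases m) auto

lemma not_dvd_two: "\<not> p dvd 2"
  using m_pos p_eq by (intro not_dvd_below) auto

lemma not_dvd_four_power: "\<not> p dvd 4 ^ k"
proof
  assume "p dvd 4 ^ k"
  then have "p dvd (2 ^ 2) ^ k" by simp
  then show False using p not_dvd_two by (metis prime_dvd_power)
qed

lemma cbin_integral: "cbin k \<in> p_integral p"
proof -
  have "of_nat ((2 * k) choose k) / of_nat (4 ^ k) \<in> p_integral p"
    using not_dvd_four_power by (intro p_integral_divide_of_nat p_integral_of_nat)
  then show ?thesis by (simp add: cbin_def)
qed

text \<open>Both sides are products of \<open>k\<close> ratios, and corresponding ratios differ by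
  \<open>p ^ 2 / (2 * k + 2) ^ 2\<close>, where \<open>2 * k + 2 < p\<close> is a unit as long as \<open>k < m\<close>.\<close>
lemma cbin_square_cong:
  assumes "k \<le> m"
  shows "rat_cong p 2 (cbin k ^ 2) ((of_nat m gchoose k) * ((- of_nat m - 1) gchoose k))"
  using assms
proof (induction k)
  case 0
  show ?case by (simp add: rat_cong_refl)
next
  case (Suc k)
  define a where "a k = (of_nat m gchoose k) * ((- of_nat m - 1 :: rat) gchoose k)" for k
  have IH: "rat_cong p 2 (cbin k ^ 2) (a k)" using Suc by (simp add: a_def)
  have "\<not> p dvd 2 * Suc k" using Suc.prems p_eq by (intro not_dvd_below) auto
  then have u: "\<not> p dvd (2 * Suc k) ^ 2" using p prime_dvd_power by blast
  have c: "of_nat ((2 * Suc k) ^ 2) * cbin (Suc k) ^ 2 = of_nat ((2 * k + 1) ^ 2) * cbin k ^ 2"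
    using arg_cong[OF cbin_Suc[of k], of "\<lambda>x. x ^ 2"] by (simp add: power_mult_distrib)
  have "of_nat ((2 * Suc k) ^ 2) * a (Suc k) = 4 * (of_nat (Suc k) ^ 2 * a (Suc k))"
    by (simp add: power2_eq_square algebra_simps)
  also have "\<dots> = 4 * ((of_nat k - of_nat m) * (of_nat k + of_nat m + 1) * a k)"
    unfolding a_def gbinomial_product_Suc ..
  also have "\<dots> = of_nat ((2 * k + 1) ^ 2) * a k - of_nat p ^ 2 * a k"
    unfolding p_eq by (simp add: power2_eq_square algebra_simps)
  finally have a: "of_nat ((2 * k + 1) ^ 2) * a k
      = of_nat ((2 * Suc k) ^ 2) * a (Suc k) + of_nat p ^ 2 * a k" by simp
  have ai: "a k \<in> p_integral p" by (rule rat_cong_integral(2)[OF IH])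
  have ai': "of_nat ((2 * Suc k) ^ 2) * a (Suc k) \<in> p_integral p"
    using a ai p_integral_diff[OF p_integral_mult[OF p_integral_of_nat ai]
      p_integral_mult[OF p_integral_of_nat[of "p ^ 2"] ai], of "(2 * k + 1) ^ 2"]
    by simp
  have "rat_cong p 2 (of_nat ((2 * Suc k) ^ 2) * cbin (Suc k) ^ 2) (of_nat ((2 * k + 1) ^ 2) * a k)"
    unfolding c by (intro rat_cong_mult rat_cong_refl IH p_integral_of_nat)
  also have "rat_cong p 2 \<dots> (of_nat ((2 * Suc k) ^ 2) * a (Suc k))"
    by (rule rat_congI[OF ai' ai a])
  finally have "rat_cong p 2 (of_nat ((2 * Suc k) ^ 2) * cbin (Suc k) ^ 2)
     (of_nat ((2 * Suc k) ^ 2) * a (Suc k))" .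
  from rat_cong_cancel[OF this u] show ?case by (simp add: a_def)
qed

lemma sum_cbin_squares_half: "rat_cong p 2 (\<Sum>k\<le>m. cbin k ^ 2) ((-1) ^ m)"
  unfolding sum_gbinomial_products[symmetric]
  by (intro rat_cong_sum cbin_square_cong) auto

text \<open>The previous congruence at \<open>k = m\<close> is quadratic on the left and linear on the right in
  the unit \<open>cbin m\<close>, so this unit cancels. The result is
  Morley's congruence for \<open>p - 1 choose m\<close>, modulo \<open>p ^ 2\<close>.\<close>
lemma cbin_half_cong: "rat_cong p 2 (cbin m) ((-1) ^ m * 4 ^ m)"
proof -
  have choose_half: "of_nat ((2 * m) choose m) = 4 ^ m * cbin m" by (simp add: cbin_def)
  have "((- of_nat m - 1 :: rat) gchoose m) = (-1) ^ m * (of_nat (2 * m) gchoose m)"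
    using gbinomial_minus[of "of_nat m + 1 :: rat" m] by simp
  also have "\<dots> = (-1) ^ m * 4 ^ m * cbin m"
    unfolding binomial_gbinomial[symmetric] choose_half by simp
  finally have gb: "((- of_nat m - 1 :: rat) gchoose m) = (-1) ^ m * 4 ^ m * cbin m" .
  have gm: "(of_nat m gchoose m) = (1 :: rat)" by (simp flip: binomial_gbinomial)
  have *: "rat_cong p 2 (cbin m ^ 2) ((-1) ^ m * 4 ^ m * cbin m)"
    using cbin_square_cong[of m] by (simp add: gb gm)
  have u: "\<not> p dvd (2 * m) choose m"
  proof
    assume "p dvd (2 * m) choose m"
    then have "p dvd fact (2 * m)"
      using binomial_fact_lemma[of m "2 * m"] by (metis dvd_mult le_add1 mult_2)
    then show False using p p_eq by (simp add: prime_dvd_fact_iff)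
  qed
  have "rat_cong p 2 (4 ^ m * cbin m ^ 2) (4 ^ m * ((-1) ^ m * 4 ^ m * cbin m))"
    using rat_cong_mult[OF rat_cong_refl[OF p_integral_of_nat[of "4 ^ m"]] *] by simp
  then have "rat_cong p 2 (of_nat ((2 * m) choose m) * cbin m)
       (of_nat ((2 * m) choose m) * ((-1) ^ m * 4 ^ m))"
    unfolding choose_half by (simp add: power2_eq_square mult_ac)
  \<comment> \<open>The factor cancelled is the integer \<open>4 ^ m * cbin m\<close>.\<close>
  from rat_cong_cancel[OF this u] show ?thesis .
qed

text \<open>The step from \<open>m\<close> to \<open>m + 1\<close> multiplies by \<open>p / (p + 1)\<close>. The later steps, up to
  \<open>k = p - 1\<close>, have denominators prime to \<open>p\<close>, so the factor \<open>p\<close> survives.\<close>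
lemma cbin_dvd_upper_half:
  assumes "m < k" "k < p"
  shows "\<exists>x \<in> p_integral p. cbin k = of_nat p * x"
  using assms
proof (induction k rule: less_induct)
  case (less k)
  obtain j where j: "k = Suc j" using less.prems by (cases k) auto
  have unit: "\<not> p dvd 2 * Suc j"
  proof
    assume "p dvd 2 * Suc j"
    then have "p dvd Suc j" using p not_dvd_two by (metis prime_dvd_mult_iff)
    then show False using not_dvd_below less.prems j by auto
  qed
  have c: "cbin k = of_nat (2 * j + 1) * cbin j / of_nat (2 * Suc j)"
    unfolding j cbin_Suc_eq by (simp add: mult_ac add_ac)
  show ?case
  proof (cases "j = m")
    case True
    then have "2 * j + 1 = p" using p_eq by simp
    then have "cbin k = of_nat p * (cbin j / of_nat (2 * Suc j))" using c by simp
    moreover have "cbin j / of_nat (2 * Suc j) \<in> p_integral p"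
      by (intro p_integral_divide_of_nat cbin_integral unit)
    ultimately show ?thesis by blast
  next
    case False
    then obtain x where x: "x \<in> p_integral p" "cbin j = of_nat p * x"
      using less.IH[of j] less.prems j by auto
    have "cbin k = of_nat p * (of_nat (2 * j + 1) * x / of_nat (2 * Suc j))"
      using c x(2) by simp
    moreover have "of_nat (2 * j + 1) * x / of_nat (2 * Suc j) \<in> p_integral p"
      by (intro p_integral_divide_of_nat p_integral_mult p_integral_of_nat x(1) unit)
    ultimately show ?thesis by blast
  qed
qed

lemma sum_cbin_squares_full: "rat_cong p 2 (\<Sum>k\<le>p-1. cbin k ^ 2) ((-1) ^ m)"
proof -
  have un: "{..p-1} = {..m} \<union> {m<..p-1}" using p_eq by auto
  have split: "(\<Sum>k\<le>p-1. cbin k ^ 2) = (\<Sum>k\<le>m. cbin k ^ 2) + (\<Sum>k\<in>{m<..p-1}. cbin k ^ 2)"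
    unfolding un by (rule sum.union_disjoint) auto
  have "rat_cong p 2 (\<Sum>k\<in>{m<..p-1}. cbin k ^ 2) (\<Sum>k\<in>{m<..p-1}. 0)"
  proof (intro rat_cong_sum)
    fix k assume k: "k \<in> {m<..p-1}"
    then obtain x where "x \<in> p_integral p" "cbin k = of_nat p * x"
      using cbin_dvd_upper_half[of k] p_eq by auto
    then show "rat_cong p 2 (cbin k ^ 2) 0"
      by (intro rat_congI[of _ "x ^ 2"])
         (auto simp: power_mult_distrib intro: p_integral_power p_integral_numeral)
  qed
  from rat_cong_add[OF sum_cbin_squares_half this] show ?thesis unfolding split by simp
qed

end

section \<open>Glaisher's congruence for Bernoulli numbers\<close>

lemma bernoulli_sum:
  "(\<Sum>j<M. of_nat (M choose j) * bernoulli j) = (if M = 1 then 1 else 0)"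
proof (cases "M \<ge> 2")
  case True
  then show ?thesis using bernoulli_sum_eq_0[of M] by auto
next
  case False
  then have "M = 0 \<or> M = 1" by auto
  then show ?thesis by auto
qed

text \<open>Both sides count the pairs of disjoint subsets of sizes \<open>i\<close> and \<open>j\<close> in a set of \<open>M\<close>
  elements.\<close>
lemma choose_mult_choose_swap:
  assumes "i + j \<le> M"
  shows "(M choose j) * ((M - j) choose i) = (M choose i) * ((M - i) choose j)"
proof -
  have "(M choose j) * ((M - j) choose i) = (M choose (i + j)) * ((i + j) choose j)"
    using choose_mult[of j "i + j" M] assms by simp
  also have "(i + j) choose j = (i + j) choose i"
    using binomial_symmetric[of j "i + j"] by simp
  also have "(M choose (i + j)) * ((i + j) choose i) = (M choose i) * ((M - i) choose j)"
    using choose_mult[of i "i + j" M] assms by simp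
  finally show ?thesis .
qed

text \<open>The sums are the Bernoulli polynomial of degree \<open>M\<close> without its constant term. Expanding
  \<open>(x + 1) ^ (M - j)\<close> and collecting the coefficient of \<open>x ^ i\<close> produces the defining sum of the
  Bernoulli numbers for \<open>M - i\<close>, which vanishes unless \<open>i = M - 1\<close>.\<close>
lemma bernoulli_polynomial_difference:
  fixes x :: rat
  shows "(\<Sum>j<M. of_nat (M choose j) * bernoulli j * (x + 1) ^ (M - j))
       - (\<Sum>j<M. of_nat (M choose j) * bernoulli j * x ^ (M - j)) = of_nat M * x ^ (M - 1)"
proof -
  have pow: "(x + 1) ^ k - x ^ k = (\<Sum>i<k. of_nat (k choose i) * x ^ i)" for k
    by (simp add: binomial_ring flip: lessThan_Suc_atMost)
  have "(\<Sum>j<M. of_nat (M choose j) * bernoulli j * (x + 1) ^ (M - j))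
       - (\<Sum>j<M. of_nat (M choose j) * bernoulli j * x ^ (M - j))
     = (\<Sum>j<M. of_nat (M choose j) * bernoulli j * ((x + 1) ^ (M - j) - x ^ (M - j)))"
    by (simp add: sum_subtractf right_diff_distrib)
  also have "\<dots> = (\<Sum>j<M. \<Sum>i<M-j. of_nat ((M choose j) * ((M - j) choose i)) * bernoulli j * x ^ i)"
    unfolding pow by (simp add: sum_distrib_left mult_ac)
  also have "\<dots> = (\<Sum>j<M. \<Sum>i<M-j. of_nat ((M choose i) * ((M - i) choose j)) * bernoulli j * x ^ i)"
    by (intro sum.cong refl, subst choose_mult_choose_swap) auto
  also have "\<dots> = (\<Sum>(j, i) \<in> (SIGMA j:{..<M}. {..<M-j}).
      of_nat ((M choose i) * ((M - i) choose j)) * bernoulli j * x ^ i)"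
    by (simp add: sum.Sigma)
  also have "\<dots> = (\<Sum>(i, j) \<in> (SIGMA i:{..<M}. {..<M-i}).
      of_nat ((M choose i) * ((M - i) choose j)) * bernoulli j * x ^ i)"
    by (rule sum.reindex_bij_witness[of _ "\<lambda>(i, j). (j, i)" "\<lambda>(i, j). (j, i)"]) auto
  also have "\<dots> = (\<Sum>i<M. \<Sum>j<M-i. of_nat ((M choose i) * ((M - i) choose j)) * bernoulli j * x ^ i)"
    by (simp add: sum.Sigma)
  also have "\<dots> = (\<Sum>i<M. of_nat (M choose i) * x ^ i
      * (\<Sum>j<M-i. of_nat ((M - i) choose j) * bernoulli j))"
    by (simp add: sum_distrib_left mult_ac)
  also have "\<dots> = (\<Sum>i<M. if i = M - 1 then of_nat (M choose i) * x ^ i else 0)"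
    unfolding bernoulli_sum by (intro sum.cong refl) auto
  also have "\<dots> = of_nat M * x ^ (M - 1)"
    by (cases M) simp_all
  finally show ?thesis .
qed

text \<open>Faulhaber's formula, by telescoping the difference equation.\<close>
lemma sum_of_powers_bernoulli:
  "of_nat (Suc n) * (\<Sum>a<N. of_nat a ^ n)
     = (\<Sum>j\<le>n. of_nat (Suc n choose j) * bernoulli j * of_nat N ^ (Suc n - j))"
proof (induction N)
  case 0
  have "(\<Sum>j\<le>n. of_nat (Suc n choose j) * bernoulli j * 0 ^ (Suc n - j)) = (\<Sum>j\<le>n. 0)"
    by (intro sum.cong refl) (simp del: binomial_Suc_Suc)
  then show ?case by simp
next
  case (Suc N)
  have "of_nat (Suc n) * (\<Sum>a<Suc N. of_nat a ^ n :: rat)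
      = of_nat (Suc n) * (\<Sum>a<N. of_nat a ^ n) + of_nat (Suc n) * of_nat N ^ n"
    by (simp only: sum.lessThan_Suc distrib_left)
  also have "\<dots> = (\<Sum>j\<le>n. of_nat (Suc n choose j) * bernoulli j * (of_nat N + 1) ^ (Suc n - j))"
    using bernoulli_polynomial_difference[of "Suc n" "of_nat N"] unfolding Suc.IH lessThan_Suc_atMost
    by (simp del: binomial_Suc_Suc of_nat_Suc)
  finally show ?case by (simp add: add.commute del: binomial_Suc_Suc)
qed

text \<open>Expand \<open>\<Prod>a\<in>A. 1 + (y a - 1)\<close>: a term with two or more factors \<open>y a - 1\<close> is divisible
  by \<open>q ^ 2\<close>. Fermat quotients are additive for this reason.\<close>
lemma prod_near_one_cong:
  fixes y :: "'a \<Rightarrow> int"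
  assumes "finite A" "\<And>a. a \<in> A \<Longrightarrow> [y a = 1] (mod q)"
  shows "[(\<Prod>a\<in>A. y a) = 1 + (\<Sum>a\<in>A. y a - 1)] (mod q ^ 2)"
  using assms
proof (induction A rule: finite_induct)
  case (insert a A)
  have "q dvd y a - 1" and "q dvd (\<Sum>a\<in>A. y a - 1)"
    using insert.prems by (auto intro!: dvd_sum simp: cong_iff_dvd_diff)
  then have "q ^ 2 dvd (y a - 1) * (\<Sum>a\<in>A. y a - 1)"
    unfolding power2_eq_square by (rule mult_dvd_mono)
  then have "[y a * (1 + (\<Sum>a\<in>A. y a - 1)) = 1 + ((y a - 1) + (\<Sum>a\<in>A. y a - 1))] (mod q ^ 2)"
    by (simp add: cong_iff_dvd_diff algebra_simps)
  moreover have "[y a * (\<Prod>a\<in>A. y a) = y a * (1 + (\<Sum>a\<in>A. y a - 1))] (mod q ^ 2)"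
    using insert by (intro cong_mult cong_refl) auto
  ultimately show ?case using insert.hyps by (simp add: cong_trans)
qed auto

context prime_localization
begin

lemma wilson_int: "[fact (p - 1) = (-1 :: int)] (mod int p)"
  using wilson_theorem[OF p] by simp

lemma fermat_int:
  assumes "\<not> p dvd a" shows "[int a ^ (p - 1) = 1] (mod int p)"
  using fermat_theorem[OF p assms] by (simp flip: cong_int_iff)

text \<open>The weak half of the von Staudt--Clausen theorem that the recursion gives for free: the
  divisors \<open>n + 2\<close> met on the way to index \<open>j < p - 1\<close> stay below \<open>p\<close>.\<close>
lemma bernoulli_integral: "j < p - 1 \<Longrightarrow> bernoulli j \<in> p_integral p"
proof (induction j rule: less_induct)
  case (less j)
  show ?case
  proof (cases j)
    case 0
    then show ?thesis by simp
  next
    case (Suc n)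
    have "(\<Sum>k\<le>n. of_nat ((n + 2) choose k) * bernoulli k) \<in> p_integral p"
      using less Suc by (intro p_integral_sum p_integral_mult p_integral_of_nat) auto
    moreover have "\<not> p dvd n + 2" using less.prems Suc by (auto dest: dvd_imp_le)
    ultimately have "- (\<Sum>k\<le>n. of_nat ((n + 2) choose k) * bernoulli k) / of_nat (n + 2) \<in> p_integral p"
      by (intro p_integral_divide_of_nat p_integral_minus)
    then show ?thesis unfolding Suc bernoulli.simps .
  qed
qed

end

context odd_prime_localization
begin

text \<open>Apply the product congruence to \<open>p - 1\<close> copies of \<open>- f\<close>; the sign disappears because
  \<open>p - 1\<close> is even.\<close>
lemma near_minus_one_power_cong:
  assumes "[f = (-1::int)] (mod int p)"
  shows "[f ^ (p - 1) = f + 2] (mod int p ^ 2)"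
proof -
  have dvd: "int p dvd f + 1" using assms by (simp add: cong_iff_dvd_diff)
  moreover have "- f - 1 = - (f + 1)" by simp
  ultimately have "[- f = 1] (mod int p)" unfolding cong_iff_dvd_diff by (simp only: dvd_minus_iff)
  then have "[(\<Prod>a<p-1. - f) = 1 + (\<Sum>a<p-1. - f - 1)] (mod int p ^ 2)"
    by (intro prod_near_one_cong) auto
  also have "1 + (\<Sum>a<p-1. - f - 1) = f + 2 - int p * (f + 1)"
    using prime_gt_0_nat[OF p] by (simp add: of_nat_diff algebra_simps)
  also have "[f + 2 - int p * (f + 1) = f + 2] (mod int p ^ 2)"
    using dvd by (simp add: cong_iff_dvd_diff power2_eq_square)
  finally have "[(- f) ^ (p - 1) = f + 2] (mod int p ^ 2)" by simp
  then show ?thesis using odd_p by simp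
qed

text \<open>The powers \<open>a ^ (p - 1)\<close> with \<open>0 < a < p\<close> are all \<open>1\<close> modulo \<open>p\<close>, so modulo \<open>p ^ 2\<close> their
  sum is determined by their product \<open>(p - 1)! ^ (p - 1)\<close>, and by Wilson's theorem the previous
  lemma evaluates that power.\<close>
lemma sum_of_fermat_powers_cong: "[(\<Sum>a<p. int a ^ (p - 1)) = int p + fact (p - 1)] (mod int p ^ 2)"
proof -
  let ?F = "fact (p - 1) :: int"
  have p1: "p > 1" using p by (rule prime_gt_1_nat)
  have "[(\<Prod>a\<in>{1..p-1}. int a ^ (p - 1)) = 1 + (\<Sum>a\<in>{1..p-1}. int a ^ (p - 1) - 1)] (mod int p ^ 2)"
    using p1 by (intro prod_near_one_cong fermat_int) (auto dest: dvd_imp_le)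
  moreover have "(\<Prod>a\<in>{1..p-1}. int a ^ (p - 1)) = ?F ^ (p - 1)"
    by (simp add: fact_prod prod_power_distrib)
  moreover have "(\<Sum>a\<in>{1..p-1}. int a ^ (p - 1) - 1) = (\<Sum>a\<in>{1..p-1}. int a ^ (p - 1)) - (int p - 1)"
    using p1 by (simp add: sum_subtractf of_nat_diff)
  moreover have "(\<Sum>a\<in>{1..p-1}. int a ^ (p - 1)) = (\<Sum>a<p. int a ^ (p - 1))"
    using p1 by (intro sum.mono_neutral_left) auto
  ultimately have "[?F ^ (p - 1) = 1 + ((\<Sum>a<p. int a ^ (p - 1)) - (int p - 1))] (mod int p ^ 2)" by simp
  then have "[?F + 2 = 1 + ((\<Sum>a<p. int a ^ (p - 1)) - (int p - 1))] (mod int p ^ 2)"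
    using near_minus_one_power_cong[OF wilson_int] cong_sym cong_trans by blast
  from cong_add[OF cong_sym[OF this] cong_refl[of "int p - 2"]] show ?thesis
    by (simp add: algebra_simps)
qed

text \<open>Faulhaber's formula for \<open>\<Sum>a<p. a ^ (p - 1)\<close>, divided by \<open>p\<close>, has the last term
  \<open>p * bernoulli (p - 1)\<close>. In a term of index \<open>0 < j < p - 1\<close> the power of \<open>p\<close> contributes one
  factor \<open>p\<close> and \<open>p choose j\<close> contributes another, and the term \<open>p ^ (p - 1)\<close> of index \<open>0\<close> vanishes as well.\<close>
lemma glaisher_bernoulli_cong:
  "rat_cong p 2 (of_nat p * bernoulli (p - 1)) (of_nat p + fact (p - 1))"
proof -
  have p3: "p \<ge> 3" using p odd_p by (metis prime_gt_1_nat One_nat_def Suc_leI le_neq_implies_less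
      numeral_2_eq_2 numeral_3_eq_3 even_numeral)
  define r where "r = (\<Sum>j<p-1. of_nat (p choose j) * bernoulli j * of_nat p ^ (p - 1 - j))"
  have p0: "of_nat p \<noteq> (0::rat)" using p3 by simp
  have "of_nat p * (\<Sum>a<p. of_nat a ^ (p - 1))
      = (\<Sum>j\<le>p-1. of_nat (p choose j) * bernoulli j * of_nat p ^ (p - j))"
    using sum_of_powers_bernoulli[of "p - 1" p] p3 by simp
  also have "\<dots> = (\<Sum>j\<le>p-1. of_nat p * (of_nat (p choose j) * bernoulli j * of_nat p ^ (p - 1 - j)))"
  proof (intro sum.cong refl)
    fix j assume "j \<in> {..p-1}"
    then have "p - j = Suc (p - 1 - j)" using p3 by auto
    then show "of_nat (p choose j) * bernoulli j * of_nat p ^ (p - j)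
       = of_nat p * (of_nat (p choose j) * bernoulli j * of_nat p ^ (p - 1 - j))" by simp
  qed
  also have "\<dots> = of_nat p * (\<Sum>j\<le>p-1. of_nat (p choose j) * bernoulli j * of_nat p ^ (p - 1 - j))"
    by (simp add: sum_distrib_left)
  finally have "(\<Sum>a<p. of_nat a ^ (p - 1))
      = (\<Sum>j\<le>p-1. of_nat (p choose j) * bernoulli j * of_nat p ^ (p - 1 - j))"
    using p0 by simp
  also have "{..p-1} = insert (p - 1) {..<p-1}" by auto
  also have "(\<Sum>j\<in>insert (p - 1) {..<p-1}. of_nat (p choose j) * bernoulli j * of_nat p ^ (p - 1 - j))
      = of_nat p * bernoulli (p - 1) + r"
    using binomial_symmetric[of "p - 1" p] p3 by (simp add: r_def)
  finally have eq: "(\<Sum>a<p. of_nat a ^ (p - 1)) = of_nat p * bernoulli (p - 1) + r" .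
  have "rat_cong p 2 r (\<Sum>j<p-1. 0)"
    unfolding r_def
  proof (intro rat_cong_sum)
    fix j assume j: "j \<in> {..<p-1}"
    have "p ^ 2 dvd (p choose j) * p ^ (p - 1 - j)"
    proof (cases "j = 0")
      case True
      \<comment> \<open>Here \<open>p choose j = 1\<close>, but the power \<open>p ^ (p - 1)\<close> suffices as \<open>p \<ge> 3\<close>.\<close>
      then show ?thesis using p3 by (simp add: le_imp_power_dvd)
    next
      case False
      then have "p dvd p choose j" using j p by (intro dvd_choose_prime) auto
      moreover have "p dvd p ^ (p - 1 - j)" using j by (intro dvd_power) auto
      ultimately show ?thesis unfolding power2_eq_square by (rule mult_dvd_mono)
    qed
    then obtain c where "(p choose j) * p ^ (p - 1 - j) = p ^ 2 * c" by (elim dvdE)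
    then have "of_nat (p choose j) * of_nat p ^ (p - 1 - j) = (of_nat p ^ 2 * of_nat c :: rat)"
      by (metis of_nat_mult of_nat_power)
    then show "rat_cong p 2 (of_nat (p choose j) * bernoulli j * of_nat p ^ (p - 1 - j)) 0"
      using j by (intro rat_congI[of _ "of_nat c * bernoulli j"])
        (auto intro!: p_integral_mult bernoulli_integral simp: mult_ac)
  qed
  then have "rat_cong p 2 (- r) 0" using rat_cong_minus by fastforce
  moreover have "rat_cong p 2 (of_int (\<Sum>a<p. int a ^ (p - 1))) (of_int (int p + fact (p - 1)))"
    unfolding rat_cong_of_int_iff by (rule sum_of_fermat_powers_cong)
  ultimately have "rat_cong p 2 (of_int (\<Sum>a<p. int a ^ (p - 1)) + - r) (of_int (int p + fact (p - 1)) + 0)"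
    by (intro rat_cong_add)
  then show ?thesis using eq by simp
qed

section \<open>The sequence at p and p - 1\<close>

lemma four_power_cong: "rat_cong p 1 (4 ^ p) 4"
proof -
  have "\<not> p dvd 4" using not_dvd_four_power[of 1] by simp
  then have "[4 * int 4 ^ (p - 1) = 4 * 1] (mod int p)"
    by (intro cong_mult cong_refl fermat_int)
  then have "[4 ^ p = 4] (mod int p ^ 1)"
    using prime_gt_0_nat[OF p] by (cases p) simp_all
  then show ?thesis unfolding rat_cong_of_int_iff[symmetric] by simp
qed

text \<open>In \<open>\<Sum>k\<le>p. (p choose k) ^ 2\<close> only the two end terms are not divisible by \<open>p\<close>.\<close>
lemma central_binomial_prime_cong: "[int ((2 * p) choose p) = 2] (mod int p)"
proof -
  have "(2 * p) choose p = 2 + (\<Sum>k\<in>{0<..<p}. (p choose k) ^ 2)"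
  proof -
    have "{..p} = insert 0 (insert p {0<..<p})" by auto
    then show ?thesis using prime_gt_0_nat[OF p] unfolding choose_square_sum[symmetric] by simp
  qed
  moreover have "p dvd (\<Sum>k\<in>{0<..<p}. (p choose k) ^ 2)"
  proof (rule dvd_sum)
    fix k assume "k \<in> {0<..<p}"
    then have "p dvd p choose k" using p by (intro dvd_choose_prime) auto
    then show "p dvd (p choose k) ^ 2" by (simp add: power2_eq_square)
  qed
  ultimately obtain c where "(2 * p) choose p = 2 + p * c" by (metis dvdE)
  then show ?thesis by (simp add: cong_iff_dvd_diff)
qed

lemma cbin_prime: "rat_cong p 1 (cbin p) (1 / 2)"
proof -
  have "rat_cong p 1 (4 * cbin p) (4 ^ p * cbin p)"
    by (intro rat_cong_mult rat_cong_refl cbin_integral rat_cong_sym[OF four_power_cong])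
  also have "4 ^ p * cbin p = of_int (int ((2 * p) choose p))" by (simp add: cbin_def)
  also have "rat_cong p 1 \<dots> (of_int 2)"
    unfolding rat_cong_of_int_iff using central_binomial_prime_cong by simp
  finally have "rat_cong p 1 (of_nat 4 * cbin p) (of_nat 4 * (1 / 2))" by simp
  then show ?thesis
    by (rule rat_cong_cancel) (use not_dvd_four_power[of 1] in simp)
qed

text \<open>The factor \<open>p ^ 2\<close> comes from \<open>(fact p) ^ 2\<close>, so the remaining factor is needed modulo \<open>p\<close>
  only. There the sum is \<open>(-1) ^ m\<close> for the terms below \<open>p\<close>, plus \<open>1 / 4\<close> for the term \<open>k = p\<close>.\<close>
lemma t_seq_prime:
  "rat_cong p 3 (of_int (t_seq p)) ((1 + 4 * (-1) ^ m) * of_nat p ^ 2)"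
proof -
  have p0: "p > 0" using p by (rule prime_gt_0_nat)
  have "fact p = (of_nat p * fact (p - 1) :: rat)" using p0 by (rule fact_reduce)
  moreover have "{..p} = insert p {..p-1}" using p0 by auto
  ultimately have t: "of_int (t_seq p)
      = of_nat p ^ 2 * (4 ^ p * fact (p - 1) ^ 2 * (cbin p ^ 2 + (\<Sum>k\<le>p-1. cbin k ^ 2)))"
    using p0 unfolding t_seq_eq_sum_squares by (simp add: power_mult_distrib mult_ac)
  have f: "rat_cong p 1 (fact (p - 1)) (-1)"
    using wilson_int rat_cong_of_int_iff[of 1 "fact (p - 1)" "-1"] by simp
  have s: "rat_cong p 1 (\<Sum>k\<le>p-1. cbin k ^ 2) ((-1) ^ m)"
    by (rule rat_cong_mono[OF sum_cbin_squares_full]) simp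
  have "rat_cong p 1 (4 ^ p * fact (p - 1) ^ 2 * (cbin p ^ 2 + (\<Sum>k\<le>p-1. cbin k ^ 2)))
     (4 * (-1) ^ 2 * ((1 / 2) ^ 2 + (-1) ^ m))"
    by (intro rat_cong_mult rat_cong_add rat_cong_power f s cbin_prime four_power_cong)
  from rat_cong_scale[OF this, of 2] show ?thesis
    unfolding t by (simp add: algebra_simps power2_eq_square numeral_3_eq_3)
qed

lemma fermat_quotient_of_two:
  obtains x where "(2 :: int) ^ (p - 1) = 1 + int p * x"
proof -
  have "[int 2 ^ (p - 1) = 1] (mod int p)"
    using not_dvd_two by (intro fermat_int)
  then show ?thesis using that by (metis cong_iff_lin cong_sym of_nat_numeral)
qed

lemma wilson_quotient:
  obtains y where "(fact (p - 1) :: int) = -1 + int p * y"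
  using wilson_int that by (metis cong_iff_lin cong_sym)

lemma four_power_half: "(4 :: 'a :: comm_semiring_1) ^ m = 2 ^ (p - 1)"
  by (simp add: p_eq power_mult)

text \<open>By the closed form the value is \<open>(-1) ^ m * 4 ^ (p - 1) * fact (p - 1) ^ 2\<close> modulo \<open>p ^ 2\<close>. With
  \<open>2 ^ (p - 1) = 1 + p * x\<close> and \<open>fact (p - 1) = -1 + p * y\<close>, this and the claimed value, with
  \<open>p + fact (p - 1)\<close> in place of the Bernoulli number, both reduce to
  \<open>(-1) ^ m * (1 + 2 * p * x - 2 * p * y)\<close>.\<close>
lemma t_seq_prime_minus_one:
  "rat_cong p 2 (of_int (t_seq (p - 1)))
     ((-1) ^ m * (2 * of_nat p + 2 ^ p - 2 + (of_nat p * bernoulli (p - 1)) ^ 2))"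
proof -
  obtain x where x: "(2 :: int) ^ (p - 1) = 1 + int p * x" by (rule fermat_quotient_of_two)
  obtain y where y: "(fact (p - 1) :: int) = -1 + int p * y" by (rule wilson_quotient)
  have pp: "2 ^ p = (2 * 2 ^ (p - 1) :: 'b :: comm_semiring_1)"
    using prime_gt_0_nat[OF p] by (simp flip: power_Suc)
  have "(4 :: int) ^ (p - 1) * fact (p - 1) ^ 2
      - (2 * int p + 2 ^ p - 2 + (int p + fact (p - 1)) ^ 2)
     = int p ^ 2 * (x ^ 2 * fact (p - 1) ^ 2 - 4 * x * y + 2 * int p * x * y ^ 2 - 1 - 2 * y)"
  proof -
    have "(4 :: int) ^ (p - 1) = (1 + int p * x) ^ 2"
      unfolding x[symmetric] by (simp add: power2_eq_square flip: power_mult_distrib)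
    then show ?thesis unfolding pp x y by (simp add: algebra_simps power2_eq_square)
  qed
  then have "[4 ^ (p - 1) * fact (p - 1) ^ 2
      = 2 * int p + 2 ^ p - 2 + (int p + fact (p - 1)) ^ 2] (mod int p ^ 2)"
    unfolding cong_iff_dvd_diff by simp
  then have 1: "rat_cong p 2 (4 ^ (p - 1) * fact (p - 1) ^ 2)
      (2 * of_nat p + 2 ^ p - 2 + (of_nat p + fact (p - 1)) ^ 2)"
    unfolding rat_cong_of_int_iff[symmetric] by simp
  have 2: "rat_cong p 2 (of_int (2 * int p + 2 ^ p - 2) + (of_nat p + fact (p - 1)) ^ 2)
      (of_int (2 * int p + 2 ^ p - 2) + (of_nat p * bernoulli (p - 1)) ^ 2)"
    by (intro rat_cong_add rat_cong_power rat_cong_const rat_cong_sym[OF glaisher_bernoulli_cong])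
  have "rat_cong p 2 (4 ^ (p - 1) * fact (p - 1) ^ 2)
      (2 * of_nat p + 2 ^ p - 2 + (of_nat p * bernoulli (p - 1)) ^ 2)"
    using rat_cong_trans[OF 1] 2 by simp
  from rat_cong_mult[OF this sum_cbin_squares_full] show ?thesis
    unfolding t_seq_eq_sum_squares by (simp add: mult.commute)
qed

section \<open>The sequence at (p - 1)/2 and (p + 1)/2\<close>
text \<open>The identity \<open>(p - 1)! = (2 * m choose m) * (m!) ^ 2\<close> combined with Morley's congruence. The
  left-hand side is grouped as \<open>4 ^ m\<close> times the value of \<open>t_seq m\<close> modulo \<open>p ^ 2\<close>.\<close>
lemma fact_half_square_cong: "[4 ^ m * (4 ^ m * fact m ^ 2) * (-1) ^ m = fact (p - 1)] (mod int p ^ 2)"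
proof -
  have "fact m ^ 2 * (4 ^ m * cbin m) = of_nat (((2 * m) choose m) * (fact m * fact m))"
    by (simp add: cbin_def power2_eq_square)
  also have "((2 * m) choose m) * (fact m * fact m) = fact (p - 1)"
    using binomial_fact_lemma[of m "2 * m"] by (simp add: p_eq mult_ac)
  finally have "fact (p - 1) = (of_int (fact m ^ 2 * 4 ^ m) * cbin m :: rat)" by simp
  then have "rat_cong p 2 (fact (p - 1)) (of_int (fact m ^ 2 * 4 ^ m) * ((-1) ^ m * 4 ^ m))"
    using rat_cong_mult[OF rat_cong_const[of 2 "fact m ^ 2 * 4 ^ m"] cbin_half_cong] by simp
  from rat_cong_sym[OF this] show ?thesis
    unfolding rat_cong_of_int_iff[symmetric] by (simp add: mult_ac)
qed

text \<open>The previous lemma says \<open>2 ^ (p - 1) * t_seq m \<equiv> (p - 1)!\<close>. Here \<open>2 ^ (p - 1) = 1 + p * x\<close>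
  has the inverse \<open>1 - p * x\<close> modulo \<open>p ^ 2\<close>, and multiplying \<open>(p - 1)! \<equiv> -1\<close> (modulo \<open>p\<close>) by
  \<open>- p * x\<close> turns the product into a sum.\<close>
lemma t_seq_half_int: "[t_seq m = fact (p - 1) + 2 ^ (p - 1) - 1] (mod int p ^ 2)"
proof -
  obtain x where x: "(2 :: int) ^ (p - 1) = 1 + int p * x" by (rule fermat_quotient_of_two)
  obtain y where y: "(fact (p - 1) :: int) = -1 + int p * y" by (rule wilson_quotient)
  have "rat_cong p 2 (of_int (t_seq m)) (of_int (4 ^ m * fact m ^ 2 * (-1) ^ m))"
    using rat_cong_mult[OF rat_cong_const[of 2 "4 ^ m * fact m ^ 2"] sum_cbin_squares_half]
    by (simp add: t_seq_eq_sum_squares)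
  then have "[t_seq m = 4 ^ m * fact m ^ 2 * (-1) ^ m] (mod int p ^ 2)"
    by (simp only: rat_cong_of_int_iff)
  then have "[4 ^ m * t_seq m = 4 ^ m * (4 ^ m * fact m ^ 2) * (-1) ^ m] (mod int p ^ 2)"
    unfolding mult.assoc by (intro cong_mult cong_refl)
  then have "[(1 + int p * x) * t_seq m = -1 + int p * y] (mod int p ^ 2)"
    using fact_half_square_cong cong_trans unfolding four_power_half x[symmetric] y[symmetric] by blast
  then obtain z where z: "(1 + int p * x) * t_seq m = -1 + int p * y + int p ^ 2 * z"
    by (metis cong_iff_lin cong_sym)
  have "t_seq m = (1 - int p * x) * ((1 + int p * x) * t_seq m) + int p ^ 2 * (x ^ 2 * t_seq m)"
    by (simp add: algebra_simps power2_eq_square)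
  then have "t_seq m - (fact (p - 1) + 2 ^ (p - 1) - 1)
      = int p ^ 2 * (z - int p * x * z - x * y + x ^ 2 * t_seq m)"
    unfolding z x y by (simp add: algebra_simps power2_eq_square)
  then show ?thesis unfolding cong_iff_dvd_diff by simp
qed

text \<open>In the recurrence at \<open>n = m\<close> the coefficient of \<open>t_seq (m - 1)\<close> contains
  \<open>(2 * m + 1) ^ 2 = p ^ 2\<close> and the coefficient of \<open>t_seq m\<close> is \<open>1 + 2 * p\<close> modulo \<open>p ^ 2\<close>;
  moreover \<open>t_seq m \<equiv> -1\<close> modulo \<open>p\<close>.\<close>
lemma t_seq_half_plus_one_int:
  "[t_seq (m + 1) = fact (p - 1) - 2 * int p + 2 ^ (p - 1) - 1] (mod int p ^ 2)"
proof -
  obtain x where x: "(2 :: int) ^ (p - 1) = 1 + int p * x" by (rule fermat_quotient_of_two)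
  obtain y where y: "(fact (p - 1) :: int) = -1 + int p * y" by (rule wilson_quotient)
  have pm: "int p = 2 * int m + 1" by (simp add: p_eq)
  obtain z where z: "t_seq m = fact (p - 1) + 2 ^ (p - 1) - 1 + int p ^ 2 * z"
    using t_seq_half_int by (metis cong_iff_lin cong_sym)
  have "8 * int m ^ 2 + 12 * int m + 5 = 2 * int p ^ 2 + 2 * int p + 1"
    unfolding pm by (simp add: algebra_simps power2_eq_square)
  then have "t_seq (m + 1) = (2 * int p ^ 2 + 2 * int p + 1) * t_seq m
      - 4 * int m ^ 2 * int p ^ 2 * t_seq (m - 1)"
    using t_seq_rec[of m] m_pos unfolding pm by simp
  then have "t_seq (m + 1) - (fact (p - 1) - 2 * int p + 2 ^ (p - 1) - 1)
     = int p ^ 2 * (2 * t_seq m + 2 * (y + x + int p * z) + z - 4 * int m ^ 2 * t_seq (m - 1))"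
    unfolding z x y by (simp add: algebra_simps power2_eq_square)
  then show ?thesis unfolding cong_iff_dvd_diff by simp
qed

lemma t_seq_half:
  "rat_cong p 2 (of_int (t_seq m)) (of_nat p * bernoulli (p - 1) - of_nat p + 2 ^ (p - 1) - 1)"
proof -
  have "rat_cong p 2 (of_int (t_seq m)) (of_int (fact (p - 1) + 2 ^ (p - 1) - 1))"
    using t_seq_half_int by (simp only: rat_cong_of_int_iff)
  also have "(of_int (fact (p - 1) + 2 ^ (p - 1) - 1) :: rat)
     = (of_nat p + fact (p - 1)) + of_int (- int p + 2 ^ (p - 1) - 1)" by simp
  also have "rat_cong p 2 \<dots> (of_nat p * bernoulli (p - 1) + of_int (- int p + 2 ^ (p - 1) - 1))"
    by (intro rat_cong_add rat_cong_const rat_cong_sym[OF glaisher_bernoulli_cong])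
  finally show ?thesis by (simp add: algebra_simps)
qed

lemma t_seq_half_plus_one:
  "rat_cong p 2 (of_int (t_seq (m + 1)))
     (of_nat p * bernoulli (p - 1) - 3 * of_nat p + 2 ^ (p - 1) - 1)"
proof -
  have "rat_cong p 2 (of_int (t_seq (m + 1))) (of_int (fact (p - 1) - 2 * int p + 2 ^ (p - 1) - 1))"
    using t_seq_half_plus_one_int by (simp only: rat_cong_of_int_iff)
  also have "(of_int (fact (p - 1) - 2 * int p + 2 ^ (p - 1) - 1) :: rat)
     = (of_nat p + fact (p - 1)) + of_int (- 3 * int p + 2 ^ (p - 1) - 1)" by simp
  also have "rat_cong p 2 \<dots> (of_nat p * bernoulli (p - 1) + of_int (- 3 * int p + 2 ^ (p - 1) - 1))"
    by (intro rat_cong_add rat_cong_const rat_cong_sym[OF glaisher_bernoulli_cong])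
  finally show ?thesis by (simp add: algebra_simps)
qed

section \<open>The sequence at (p - 3)/4\<close>
text \<open>Modulo \<open>p\<close> the number \<open>-1/2\<close>, whose generalized binomial coefficients are
  \<open>(-1) ^ k * cbin k\<close>, equals \<open>m\<close>.\<close>
lemma cbin_cong:
  assumes "k \<le> m"
  shows "rat_cong p 1 (cbin k) ((-1) ^ k * of_nat (m choose k))"
  using assms
proof (induction k)
  case 0
  show ?case by (simp add: rat_cong_refl)
next
  case (Suc k)
  define b where "b k = (-1) ^ k * int (m choose k)" for k
  have IH: "rat_cong p 1 (cbin k) (of_int (b k))" using Suc by (simp add: b_def)
  have u: "\<not> p dvd 2 * k + 2" using Suc.prems p_eq by (intro not_dvd_below) auto
  have "Suc k * (m choose Suc k) = (m - k) * (m choose k)"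
    using binomial_absorb_comp[of m k] binomial_absorption[of k m] by simp
  then have "int (Suc k) * int (m choose Suc k) = (int m - int k) * int (m choose k)"
    using Suc.prems by (metis Suc_leD of_nat_diff of_nat_mult)
  moreover have "int (2 * k + 2) * b (Suc k) = - 2 * (-1) ^ k * (int (Suc k) * int (m choose Suc k))"
    by (simp add: b_def algebra_simps)
  ultimately have eq: "int (2 * k + 2) * b (Suc k) = - 2 * (-1) ^ k * ((int m - int k) * int (m choose k))"
    by (simp only:)
  have "int (2 * k + 1) * b k - int (2 * k + 2) * b (Suc k) = int p * b k"
    unfolding eq by (simp add: b_def p_eq algebra_simps)
  then have "[int (2 * k + 1) * b k = int (2 * k + 2) * b (Suc k)] (mod int p ^ 1)"
    by (simp add: cong_iff_dvd_diff)
  then have 1: "rat_cong p 1 (of_nat (2 * k + 1) * of_int (b k)) (of_nat (2 * k + 2) * of_int (b (Suc k)))"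
    unfolding rat_cong_of_int_iff[symmetric] by simp
  have "rat_cong p 1 (of_nat (2 * k + 2) * cbin (Suc k)) (of_nat (2 * k + 1) * of_int (b k))"
    unfolding cbin_Suc by (intro rat_cong_mult rat_cong_refl p_integral_of_nat IH)
  from rat_cong_cancel[OF rat_cong_trans[OF this 1] u] show ?case by (simp add: b_def)
qed

text \<open>Modulo \<open>p\<close> the summands are the squares \<open>(m choose k) ^ 2\<close>, symmetric about \<open>m / 2\<close>. As \<open>m\<close>
  is odd, the indices up to \<open>n\<close> are exactly one half of all indices.\<close>
lemma sum_cbin_squares_quarter:
  assumes "m = 2 * n + 1"
  shows "rat_cong p 1 (2 * (\<Sum>k\<le>n. cbin k ^ 2)) (-1)"
proof -
  have sq: "rat_cong p 1 (cbin k ^ 2) (of_nat (m choose k) ^ 2)" if "k \<le> m" for k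
    using rat_cong_power[OF cbin_cong[OF that], of 2] by (simp add: power_mult_distrib flip: power_mult)
  have un: "{..m} = {..n} \<union> {n<..m}" using assms by auto
  have "(\<Sum>k\<le>m. (m choose k) ^ 2) = (\<Sum>k\<le>n. (m choose k) ^ 2) + (\<Sum>k\<in>{n<..m}. (m choose k) ^ 2)"
    unfolding un by (rule sum.union_disjoint) auto
  also have "(\<Sum>k\<in>{n<..m}. (m choose k) ^ 2) = (\<Sum>k\<le>n. (m choose k) ^ 2)"
    by (rule sum.reindex_bij_witness[of _ "\<lambda>k. m - k" "\<lambda>k. m - k"])
       (use assms in \<open>auto simp: binomial_symmetric[symmetric]\<close>)
  finally have eq: "2 * (\<Sum>k\<le>n. of_nat (m choose k) ^ 2) = (\<Sum>k\<le>m. of_nat (m choose k) ^ 2 :: rat)"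
    by (simp flip: of_nat_power of_nat_sum)
  have "rat_cong p 1 (of_nat 2 * (\<Sum>k\<le>n. cbin k ^ 2)) (of_nat 2 * (\<Sum>k\<le>n. of_nat (m choose k) ^ 2))"
    using assms by (intro rat_cong_mult rat_cong_refl p_integral_of_nat rat_cong_sum sq) auto
  then have "rat_cong p 1 (2 * (\<Sum>k\<le>n. cbin k ^ 2)) (\<Sum>k\<le>m. of_nat (m choose k) ^ 2)"
    by (simp add: eq)
  also have "rat_cong p 1 \<dots> (\<Sum>k\<le>m. cbin k ^ 2)"
    by (intro rat_cong_sum rat_cong_sym[OF sq]) auto
  also have "rat_cong p 1 \<dots> ((-1) ^ m)"
    by (rule rat_cong_mono[OF sum_cbin_squares_half]) simp
  finally show ?thesis using assms by simp
qed

text \<open>Multiply \<open>2 * t_seq n \<equiv> - (4 ^ n * (n!) ^ 2)\<close> by \<open>2 * (n + 1) * (m choose n)\<close>: on the left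
  \<open>4 * (n + 1) = p + 1 \<equiv> 1\<close>, and on the right \<open>m choose n\<close> cancels the denominator of
  \<open>m! = n! * (n + 1)! * (m choose n)\<close>.\<close>
lemma t_seq_quarter_int:
  assumes "m = 2 * n + 1"
  shows "[t_seq n * int (m choose n) = - (2 ^ m * fact m)] (mod int p)"
proof -
  have "rat_cong p 1 (of_int (2 * t_seq n)) (of_int (- (4 ^ n * fact n ^ 2)))"
    using rat_cong_mult[OF rat_cong_const[of 1 "4 ^ n * fact n ^ 2"] sum_cbin_squares_quarter[OF assms]]
    by (simp add: t_seq_eq_sum_squares mult_ac)
  then have "[2 * t_seq n = - (4 ^ n * fact n ^ 2)] (mod int p)"
    by (simp add: rat_cong_of_int_iff del: of_int_mult of_int_minus)
  then have "[2 * t_seq n * (2 * (int n + 1) * int (m choose n))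
      = - (4 ^ n * fact n ^ 2) * (2 * (int n + 1) * int (m choose n))] (mod int p)"
    by (intro cong_mult cong_refl)
  moreover have "- (4 ^ n * fact n ^ 2) * (2 * (int n + 1) * int (m choose n)) = - (2 ^ m * fact m)"
  proof -
    have "fact n * fact (n + 1) * (m choose n) = fact m"
      using binomial_fact_lemma[of n m] assms by simp
    then have "(fact m :: int) = fact n * fact (n + 1) * int (m choose n)"
      by (metis of_nat_fact of_nat_mult)
    moreover have "(2 :: int) ^ m = 2 * 4 ^ n" by (simp add: assms power_mult)
    ultimately show ?thesis by (simp add: power2_eq_square algebra_simps)
  qed
  moreover have "[2 * t_seq n * (2 * (int n + 1) * int (m choose n)) = t_seq n * int (m choose n)] (mod int p)"
  proof -
    have "2 * t_seq n * (2 * (int n + 1) * int (m choose n)) - t_seq n * int (m choose n)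
      = int p * (t_seq n * int (m choose n))" by (simp add: p_eq assms algebra_simps)
    then show ?thesis unfolding cong_iff_dvd_diff by simp
  qed
  ultimately show ?thesis by (metis cong_sym cong_trans)
qed

text \<open>For odd \<open>m\<close>, \<open>fact_half_square_cong\<close> and Wilson's theorem combine to
  \<open>(4 ^ m * fact m) ^ 2 \<equiv> 1\<close>, and \<open>4 ^ m = 2 ^ (p - 1) \<equiv> 1\<close>.\<close>
lemma two_power_fact_half_square:
  assumes "odd m"
  shows "[(2 ^ m * fact m) ^ 2 = 1] (mod int p)"
proof -
  have "\<not> p dvd 2" by (rule not_dvd_two)
  then have f: "[4 ^ m = 1] (mod int p)"
    using fermat_int[of 2] by (simp add: four_power_half)
  have "[4 ^ m * (4 ^ m * fact m ^ 2) * (-1) ^ m = (fact (p - 1) :: int)] (mod int p)"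
    using fact_half_square_cong by (rule cong_dvd_modulus) simp
  then have "[- (4 ^ m * (4 ^ m * fact m ^ 2)) = (-1 :: int)] (mod int p)"
    using wilson_int cong_trans assms by fastforce
  then have "[4 ^ m * (4 ^ m * fact m ^ 2) = (1 :: int)] (mod int p)"
    using cong_minus_minus_iff by blast
  moreover have "[4 ^ m * (4 ^ m * fact m ^ 2) = 1 * (4 ^ m * fact m ^ 2)] (mod int p)"
    by (intro cong_mult f cong_refl)
  ultimately have "[4 ^ m * fact m ^ 2 = (1 :: int)] (mod int p)"
    by (metis cong_sym cong_trans mult_1)
  moreover have "(2 ^ m) ^ 2 = (4 :: int) ^ m"
    by (simp add: power2_eq_square flip: power_mult_distrib)
  then have "(2 ^ m * fact m) ^ 2 = (4 ^ m * fact m ^ 2 :: int)"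
    by (simp add: power_mult_distrib)
  ultimately show ?thesis by simp
qed

lemma t_seq_quarter:
  assumes "m = 2 * n + 1"
  shows "rat_cong p 1 (of_int (t_seq n)) (1 / of_nat (m choose n))
    \<or> rat_cong p 1 (of_int (t_seq n)) (- (1 / of_nat (m choose n)))"
proof -
  have "odd m" using assms by simp
  have "int p dvd (2 ^ m * fact m) ^ 2 - 1"
    using two_power_fact_half_square[OF \<open>odd m\<close>] by (simp add: cong_iff_dvd_diff)
  also have "(2 ^ m * fact m :: int) ^ 2 - 1 = (2 ^ m * fact m - 1) * (2 ^ m * fact m + 1)"
    by (simp add: algebra_simps power2_eq_square)
  finally have "int p dvd 2 ^ m * fact m - 1 \<or> int p dvd 2 ^ m * fact m + 1"
    using p by (simp add: prime_dvd_mult_iff)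
  then have "[2 ^ m * fact m = 1] (mod int p) \<or> [2 ^ m * fact m = -1] (mod int p)"
    by (auto simp: cong_iff_dvd_diff)
  then obtain s :: int where s: "s = 1 \<or> s = -1" "[- (2 ^ m * fact m) = s] (mod int p)"
    using cong_minus_minus_iff by (metis minus_minus)
  have "[t_seq n * int (m choose n) = s] (mod int p)"
    using t_seq_quarter_int[OF assms] s(2) by (rule cong_trans)
  then have c: "rat_cong p 1 (of_int (int (m choose n) * t_seq n)) (of_int s)"
    by (simp add: rat_cong_of_int_iff mult.commute del: of_int_mult)
  have u: "\<not> p dvd m choose n"
  proof
    assume "p dvd m choose n"
    then have "p dvd fact m" using binomial_fact_lemma[of n m] assms by (metis dvd_mult le_add1 mult_2 add.assoc)
    then show False using p p_eq by (simp add: prime_dvd_fact_iff)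
  qed
  have "of_nat (m choose n) \<noteq> (0 :: rat)" using u by (metis dvd_0_right of_nat_eq_0_iff)
  then have "rat_cong p 1 (of_nat (m choose n) * of_int (t_seq n))
      (of_nat (m choose n) * (of_int s / of_nat (m choose n)))"
    using c by simp
  from rat_cong_cancel[OF this u] show ?thesis using s(1) by auto
qed

end

theorem theorem3p3:
  fixes p :: nat
  assumes "prime p" and "odd p"
  shows "rat_cong p 3 (of_int (t_seq p))
           ((1 + 4 * (-1) ^ ((p - 1) div 2)) * of_nat p ^ 2) \<and>
         rat_cong p 2 (of_int (t_seq (p - 1)))
           ((-1) ^ ((p - 1) div 2) *
             (2 * of_nat p + 2 ^ p - 2 + (of_nat p * bernoulli (p - 1)) ^ 2)) \<and>
         rat_cong p 2 (of_int (t_seq ((p - 1) div 2)))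
           (of_nat p * bernoulli (p - 1) - of_nat p + 2 ^ (p - 1) - 1) \<and>
         rat_cong p 2 (of_int (t_seq ((p + 1) div 2)))
           (of_nat p * bernoulli (p - 1) - 3 * of_nat p + 2 ^ (p - 1) - 1) \<and>
         ([p = 3] (mod 4) \<longrightarrow>
           rat_cong p 1 (of_int (t_seq ((p - 3) div 4)))
             (1 / of_nat (((p - 1) div 2) choose ((p - 3) div 4))) \<or>
           rat_cong p 1 (of_int (t_seq ((p - 3) div 4)))
             (- (1 / of_nat (((p - 1) div 2) choose ((p - 3) div 4)))))"
proof -
  obtain m where m: "p = 2 * m + 1" using assms(2) by (rule oddE)
  interpret odd_prime_localization p m using assms(1) m by unfold_locales
  have half: "(p - 1) div 2 = m" and half': "(p + 1) div 2 = m + 1" using m by auto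
  have quarter: "m = 2 * ((p - 3) div 4) + 1" if "[p = 3] (mod 4)"
    using that m unfolding cong_def by presburger
  show ?thesis
    unfolding half half'
    using t_seq_prime t_seq_prime_minus_one t_seq_half t_seq_half_plus_one t_seq_quarter[OF quarter]
    by blast
qed

end
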